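(* Let $1 \leq t \leq r$, let $\mathcal{F}$ be a $(\leq r)$-family, let $m \geq c(r,r,t)+t$, and let $\mathcal{F}_1 = \dots = \mathcal{F}_k = \mathcal{S}^*_{\mathcal{F},m}$ (with $k\geq 2$). Then $(\mathcal{F}_1, \dots, \mathcal{F}_k)$ has the extrastrong cross-$t$-star property.
   Context: All sets and families are finite. For an $r$-element set $X=\{x_1,\dots,x_r\}$ and integer $m\geq1$, $\mathcal{S}^*_{X,m}=\{\{(x_1,y_1),\dots,(x_r,y_r)\}: y_1,\dots,y_r \text{ distinct elements of } [m]\}$, with $\mathcal{S}^*_{\emptyset,m}=\emptyset$; $\mathcal{S}^*_{\mathcal{F},m}=\bigcup_{F\in\mathcal{F}}\mathcal{S}^*_{F,m}$. A $(\leq r)$-family is one whose sets each have at most $r$ elements. For $t\leq r$, $c(r,r,t)=r\binom{r}{t}+1$. $\mathcal{G}(T)=\{G\in\mathcal{G}:T\subseteq G\}$. Families $\mathcal{A}_1,\dots,\mathcal{A}_k$ are cross-$t$-intersecting if for all distinct $i,j$ each set of $\mathcal{A}_i$ shares at least $t$ elements with each set of $\mathcal{A}_j$; the tuple is below $(\mathcal{F}_1,\dots,\mathcal{F}_k)$ if $\mathcal{A}_i\subseteq\mathcal{F}_i$. Extrastrong cross-$t$-star property: there is a $t$-set $T$ such that for every cross-$t$-intersecting tuple below $(\mathcal{F}_1,\dots,\mathcal{F}_k)$, $\prod|\mathcal{A}_i|\leq\prod|\mathcal{F}_i(T)|$, with equality only if there is a $t$-set $T'$ with $\mathcal{A}_i=\mathcal{F}_i(T')$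 for all $i$.
   Formalization: Added hypothesis: F has no nonempty member, or some member of F has at least t elements; otherwise all t-stars are empty and the tuple (F_1, ∅, …, ∅) attains equality (0 = 0) without consisting of stars, so the claim fails. *)

theory Defs
  imports Main
begin

text \<open>
  All sets and families are finite, so finiteness is part of the notions below.
  A family is a value of type \<open>'b set set\<close>; a tuple of families
  \<open>(F\<^sub>1, \<dots>, F\<^sub>k)\<close> is a function on \<open>nat\<close>, of which only the values on
  \<open>{1..k}\<close> matter.
\<close>

definition le_family :: "nat \<Rightarrow> 'a set set \<Rightarrow> bool" where
  "le_family r \<F> \<longleftrightarrow> finite \<F> \<and> (\<forall>X\<in>\<F>. finite X \<and> card X \<le> r)"

text \<open>
  The set \<open>{(x\<^sub>1,y\<^sub>1),\<dots>,(x\<^sub>r,y\<^sub>r)}\<close> with distinct \<open>y\<^sub>i \<in> [m]\<close> is the graph of an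
  injection \<open>X \<rightarrow> [m]\<close>. By convention the empty set contributes no member (and not
  the empty graph).
\<close>

definition Sstar :: "'a set \<Rightarrow> nat \<Rightarrow> ('a \<times> nat) set set" where
  "Sstar X m =
     (if X = {} then {}
      else {(\<lambda>x. (x, y x)) ` X | y. inj_on y X \<and> y ` X \<subseteq> {1..m}})"

definition Sstar_family :: "'a set set \<Rightarrow> nat \<Rightarrow> ('a \<times> nat) set set" where
  "Sstar_family \<F> m = (\<Union>X\<in>\<F>. Sstar X m)"

text \<open>The value \<open>c(r,r,t)\<close>.\<close>

definition c_rr :: "nat \<Rightarrow> nat \<Rightarrow> nat" where
  "c_rr r t = r * (r choose t) + 1"

definition star :: "'b set set \<Rightarrow> 'b set \<Rightarrow> 'b set set" where
  "star \<G> T = {G \<in> \<G>. T \<subseteq> G}"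

definition t_set :: "nat \<Rightarrow> 'b set \<Rightarrow> bool" where
  "t_set t T \<longleftrightarrow> finite T \<and> card T = t"

definition cross_t_intersecting :: "nat \<Rightarrow> nat \<Rightarrow> (nat \<Rightarrow> 'b set set) \<Rightarrow> bool" where
  "cross_t_intersecting t k \<A> \<longleftrightarrow>
     (\<forall>i\<in>{1..k}. \<forall>j\<in>{1..k}. i \<noteq> j \<longrightarrow>
        (\<forall>A\<in>\<A> i. \<forall>B\<in>\<A> j. t \<le> card (A \<inter> B)))"

definition below :: "nat \<Rightarrow> (nat \<Rightarrow> 'b set set) \<Rightarrow> (nat \<Rightarrow> 'b set set) \<Rightarrow> bool" where
  "below k \<A> Fs \<longleftrightarrow> (\<forall>i\<in>{1..k}. \<A> i \<subseteq> Fs i)"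

definition extrastrong_cross_t_star :: "nat \<Rightarrow> nat \<Rightarrow> (nat \<Rightarrow> 'b set set) \<Rightarrow> bool" where
  "extrastrong_cross_t_star t k Fs \<longleftrightarrow>
     (\<exists>T. t_set t T \<and>
        (\<forall>\<A>. cross_t_intersecting t k \<A> \<and> below k \<A> Fs \<longrightarrow>
           (\<Prod>i\<in>{1..k}. card (\<A> i)) \<le> (\<Prod>i\<in>{1..k}. card (star (Fs i) T)) \<and>
           ((\<Prod>i\<in>{1..k}. card (\<A> i)) = (\<Prod>i\<in>{1..k}. card (star (Fs i) T)) \<longrightarrow>
              (\<exists>T'. t_set t T' \<and> (\<forall>i\<in>{1..k}. \<A> i = star (Fs i) T')))))"

text \<open>
  If \<open>\<F>\<close> has a nonempty member but none with at least \<open>t\<close> elements (so \<open>t \<ge> 2\<close>),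
  the equality clause fails for a trivial reason: all stars are empty, so the tuple
  \<open>(F\<^sub>1, {}, \<dots>, {})\<close> attains the maximum product \<open>0\<close> without being a tuple of stars.
  The following lemma records this; it is why the theorem assumes
  \<open>\<F> \<subseteq> {{}} \<or> (\<exists>X\<in>\<F>. t \<le> card X)\<close>, which always holds for \<open>t = 1\<close>.
\<close>

lemma degenerate_not_extrastrong:
  fixes \<F> :: "'a set set"
  assumes fam: "le_family r \<F>" and "k \<ge> 2" and "m \<ge> r"
    and deg: "\<not> (\<F> \<subseteq> {{}} \<or> (\<exists>X\<in>\<F>. t \<le> card X))"
  shows "\<not> extrastrong_cross_t_star t k (\<lambda>_. Sstar_family \<F> m)"
proof
  let ?S = "Sstar_family \<F> m"
  assume "extrastrong_cross_t_star t k (\<lambda>_. ?S)"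
  then obtain T where T: "t_set t T"
    and ext: "\<And>\<A>. \<lbrakk>cross_t_intersecting t k \<A>; below k \<A> (\<lambda>_. ?S);
       (\<Prod>i\<in>{1..k}. card (\<A> i)) = (\<Prod>i\<in>{1..k}. card (star ?S T))\<rbrakk> \<Longrightarrow>
       \<exists>T'. t_set t T' \<and> (\<forall>i\<in>{1..k}. \<A> i = star ?S T')"
    unfolding extrastrong_cross_t_star_def by blast
  have no_star: "star ?S T' = {}" if "t_set t T'" for T'
  proof (rule ccontr)
    assume "star ?S T' \<noteq> {}"
    then obtain X y where X: "X \<in> \<F>" and sub: "T' \<subseteq> (\<lambda>x. (x, y x)) ` X"
      unfolding star_def Sstar_family_def Sstar_def by (auto split: if_splits)
    have "finite X" using fam X unfolding le_family_def by blast
    then have "card T' \<le> card X"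
      using card_mono[OF _ sub] card_image_le[of X "\<lambda>x. (x, y x)"] by force
    then show False using that deg X unfolding t_set_def by auto
  qed
  define \<A> where "\<A> = (\<lambda>i::nat. if i = 1 then ?S else {})"
  have "cross_t_intersecting t k \<A>" "below k \<A> (\<lambda>_. ?S)"
    unfolding cross_t_intersecting_def below_def \<A>_def by auto
  moreover have "(\<Prod>i\<in>{1..k}. card (\<A> i)) = 0"
    using \<open>k \<ge> 2\<close> by (intro prod_zero bexI[of _ 2]) (auto simp: \<A>_def)
  moreover have "(\<Prod>i\<in>{1..k}. card (star ?S T)) = 0"
    using \<open>k \<ge> 2\<close> no_star[OF T] by simp
  ultimately obtain T' where T': "t_set t T'" "\<forall>i\<in>{1..k}. \<A> i = star ?S T'"
    using ext[of \<A>] by metis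
  then have "\<A> 1 = star ?S T'" using \<open>k \<ge> 2\<close> by simp
  then have "?S = {}" using no_star[OF T'(1)] by (simp add: \<A>_def)
  moreover obtain X where X: "X \<in> \<F>" "X \<noteq> {}" using deg by blast
  then have fin: "finite X" and "card X \<le> card {1..m}"
    using fam \<open>m \<ge> r\<close> unfolding le_family_def by auto
  then obtain y where "inj_on y X" "y ` X \<subseteq> {1..m}"
    using card_le_inj[of X "{1..m}"] by auto
  then have "(\<lambda>x. (x, y x)) ` X \<in> ?S"
    using X unfolding Sstar_family_def Sstar_def by auto
  ultimately show False by blast
qed

end

theory Submission
  imports Defs "HOL-Combinatorics.Transposition"
begin

text \<open>
  Let \<open>\<G>\<close> be the family of graphs and \<open>L\<close> the size of its largest \<open>t\<close>-star. Swapping two values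
  in the graphs through \<open>T \<union> {x}\<close> shows that \<open>\<G>(T \<union> {x})\<close> is at least \<open>m - t\<close> times smaller
  than \<open>\<G>(T)\<close>. Take cross-\<open>t\<close>-intersecting \<open>\<A>\<close> and \<open>\<B>\<close>. If \<open>T \<subseteq> A\<close> for all \<open>A \<in> \<A>\<close> but some
  \<open>B \<in> \<B>\<close> does not contain the \<open>t\<close>-set \<open>T\<close>, each member of \<open>\<A>\<close> contains a further element of \<open>B\<close>,
  so \<open>\<A>\<close> has size at most \<open>r L / (m - t)\<close>, while \<open>\<B>\<close> has size at most \<open>(r choose t) L\<close>. If neither
  family lies in a \<open>t\<close>-star, both bounds apply at once and each family is smaller than \<open>L\<close>. Hence
  \<open>|\<A>| |\<B>| < L\<^sup>2\<close> unless both families lie in the same \<open>t\<close>-star. For \<open>k\<close> families, at most one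
  can exceed \<open>L\<close>, and it is compensated by any other one.
\<close>

section \<open>Stars, and graphs of injections as sets of pairs\<close>

lemma finite_star: "finite \<G> \<Longrightarrow> finite (star \<G> T)"
  by (simp add: star_def)

lemma star_mono: "\<A> \<subseteq> \<G> \<Longrightarrow> star \<A> T \<subseteq> star \<G> T"
  by (auto simp: star_def)

text \<open>Eliminates the choice of \<open>y\<close>: injectivity of \<open>fst\<close> makes a set
  of pairs a graph, and injectivity of \<open>y\<close> becomes injectivity of \<open>snd\<close>.
  In this form membership can be checked for images of graphs.\<close>

lemma Sstar_iff:
  "F \<in> Sstar X m \<longleftrightarrow>
     X \<noteq> {} \<and> fst ` F = X \<and> inj_on fst F \<and> inj_on snd F \<and> snd ` F \<subseteq> {1..m}"
proof
  assume "F \<in> Sstar X m"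
  then obtain y where "X \<noteq> {}" "F = (\<lambda>x. (x, y x)) ` X" "inj_on y X" "y ` X \<subseteq> {1..m}"
    by (auto simp: Sstar_def split: if_splits)
  then show "X \<noteq> {} \<and> fst ` F = X \<and> inj_on fst F \<and> inj_on snd F \<and> snd ` F \<subseteq> {1..m}"
    by (auto simp: inj_on_def image_image)
next
  assume F: "X \<noteq> {} \<and> fst ` F = X \<and> inj_on fst F \<and> inj_on snd F \<and> snd ` F \<subseteq> {1..m}"
  define y where "y = (\<lambda>x. snd (inv_into F fst x))"
  have y: "y (fst p) = snd p" if "p \<in> F" for p
    using F that by (simp add: y_def)
  have "F = (\<lambda>x. (x, y x)) ` fst ` F"
    using y by (force simp: image_image)
  moreover have "inj_on y (fst ` F)"
  proof (rule inj_onI, clarify)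
    fix p q assume "p \<in> F" "q \<in> F" "y (fst p) = y (fst q)"
    then have "p = q" using F y by (metis inj_onD)
    then show "fst p = fst q" by simp
  qed
  moreover have "y ` fst ` F \<subseteq> {1..m}"
    using F y by (auto simp: image_subset_iff)
  ultimately show "F \<in> Sstar X m"
    using F by (auto simp: Sstar_def)
qed

lemma Sstar_family_iff:
  "F \<in> Sstar_family \<F> m \<longleftrightarrow>
     F \<noteq> {} \<and> fst ` F \<in> \<F> \<and> inj_on fst F \<and> inj_on snd F \<and> snd ` F \<subseteq> {1..m}"
  by (auto simp: Sstar_family_def Sstar_iff)

lemma Sstar_family_finite_card:
  assumes "le_family r \<F>" "F \<in> Sstar_family \<F> m"
  shows "finite F" "card F \<le> r"
proof -
  have F: "inj_on fst F" "fst ` F \<in> \<F>"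
    using assms(2) by (auto simp: Sstar_family_iff)
  then show "finite F"
    using assms(1) finite_imageD unfolding le_family_def by blast
  show "card F \<le> r"
    using F assms(1) card_image[of fst F] unfolding le_family_def by force
qed

lemma finite_Sstar_family:
  assumes "le_family r \<F>"
  shows "finite (Sstar_family \<F> m)"
proof (rule finite_subset)
  show "Sstar_family \<F> m \<subseteq> Pow (\<Union>\<F> \<times> {1..m})"
  proof (intro subsetI PowI)
    fix F p assume "F \<in> Sstar_family \<F> m" "p \<in> F"
    then have "fst p \<in> \<Union>\<F>" "snd p \<in> {1..m}"
      unfolding Sstar_family_iff by blast+
    then show "p \<in> \<Union>\<F> \<times> {1..m}" by (simp add: mem_Times_iff)
  qed
  show "finite (Pow (\<Union>\<F> \<times> {1..m}))"
    using assms by (auto simp: le_family_def)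
qed

section \<open>The swap inequality\<close>

text \<open>With \<open>x = (a, b)\<close>, exchange the values \<open>b\<close> and
  \<open>v\<close> throughout the graph, for any \<open>v\<close> not taken on \<open>T\<close>;
  this keeps values distinct and fixes \<open>T\<close>. The choice \<open>v = b\<close> is allowed,
  so the factor is \<open>m - t\<close> and not one less.\<close>

lemma card_star_insert_le:
  assumes fam: "le_family r \<F>" and T: "t_set t T" and x: "x \<notin> T"
  shows "(m - t) * card (star (Sstar_family \<F> m) (insert x T)) \<le> card (star (Sstar_family \<F> m) T)"
proof -
  let ?G = "Sstar_family \<F> m"
  obtain a b where ab: "x = (a, b)" by fastforce
  define V where "V = {1..m} - snd ` T"
  define swap where "swap = (\<lambda>(F :: ('a \<times> nat) set, v). map_prod id (transpose b v) ` F)"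
  have "inj_on swap (star ?G (insert x T) \<times> V)"
  proof (rule inj_onI, clarify)
    fix F v F' v'
    assume F: "F \<in> star ?G (insert x T)" and F': "F' \<in> star ?G (insert x T)"
      and eq: "swap (F, v) = swap (F', v')"
    \<comment> \<open>The swapped graph reveals \<open>v\<close> as its value at \<open>a\<close>;
      once \<open>v\<close> is known, the swap can be undone.\<close>
    have "(a, v') \<in> map_prod id (transpose b v') ` F'"
      using F' ab by (force simp: star_def)
    then have "(a, v') \<in> map_prod id (transpose b v) ` F"
      using eq by (simp add: swap_def)
    then obtain w where w: "(a, w) \<in> F" "v' = transpose b v w" by auto
    moreover have "(a, b) \<in> F" "inj_on fst F"
      using F ab by (auto simp: star_def Sstar_family_iff)
    ultimately have "w = b" using inj_onD[of fst F "(a, w)" "(a, b)"] by simp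
    with w have v: "v' = v" by simp
    have "inj (map_prod id (transpose b v) :: 'a \<times> nat \<Rightarrow> _)"
      by (intro prod.inj_map) auto
    with eq v show "F = F' \<and> v = v'"
      by (simp add: swap_def inj_image_eq_iff)
  qed
  moreover have "swap ` (star ?G (insert x T) \<times> V) \<subseteq> star ?G T"
  proof (rule image_subsetI, clarify)
    fix F v assume F: "F \<in> star ?G (insert x T)" and v: "v \<in> V"
    let ?F = "map_prod id (transpose b v) ` F"
    have FG: "F \<noteq> {}" "fst ` F \<in> \<F>" "inj_on fst F" "inj_on snd F" "snd ` F \<subseteq> {1..m}"
      and sub: "T \<subseteq> F" "(a, b) \<in> F"
      using F ab by (auto simp: star_def Sstar_family_iff)
    have fst: "fst ` ?F = fst ` F" by (force simp: image_image)
    have snd: "snd ` ?F = transpose b v ` snd ` F" by (force simp: image_image)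
    have "b \<in> {1..m}" "v \<in> {1..m}" using FG sub v by (auto simp: V_def)
    then have "transpose b v ` {1..m} \<subseteq> {1..m}"
      by (auto simp: transpose_def)
    then have "snd ` ?F \<subseteq> {1..m}" using FG(5) unfolding snd by blast
    moreover have "inj_on fst ?F" using FG(3) by (auto simp: inj_on_def)
    moreover have "inj_on snd ?F"
    proof (rule inj_onI)
      fix p q assume "p \<in> ?F" "q \<in> ?F" and eq: "snd p = snd q"
      then obtain p' q' where pq: "p' \<in> F" "q' \<in> F"
          "p = map_prod id (transpose b v) p'" "q = map_prod id (transpose b v) q'"
        by (elim imageE) (rule that)
      with eq have "snd p' = snd q'"
        by (metis snd_map_prod transpose_involutory)
      with pq FG(4) have "p' = q'" by (metis inj_onD)
      with pq show "p = q" by simp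
    qed
    ultimately have "?F \<in> ?G" using FG fst by (auto simp: Sstar_family_iff)
    moreover have "T \<subseteq> ?F"
    proof
      fix p assume p: "p \<in> T"
      \<comment> \<open>Within \<open>F\<close> only \<open>x\<close> has the value
        \<open>b\<close>, and \<open>x\<close> is outside \<open>T\<close>; so the swap moves no
        pair of \<open>T\<close>.\<close>
      have "snd p \<noteq> b"
        using p sub FG(4) x ab by (metis inj_onD snd_conv subsetD)
      moreover have "snd p \<noteq> v" using p v by (auto simp: V_def)
      ultimately have "map_prod id (transpose b v) p = p"
        by (cases p) auto
      then show "p \<in> ?F" using p sub by (metis image_eqI subsetD)
    qed
    ultimately show "swap (F, v) \<in> star ?G T" by (simp add: star_def swap_def)
  qed
  ultimately have le: "card (star ?G (insert x T) \<times> V) \<le> card (star ?G T)"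
    using finite_star[OF finite_Sstar_family[OF fam]] by (metis card_inj_on_le)
  have "m - t \<le> card V"
    using diff_card_le_card_Diff[of "snd ` T" "{1..m}"] card_image_le[of T snd] T
    by (auto simp: V_def t_set_def)
  then have "(m - t) * card (star ?G (insert x T)) \<le> card (star ?G (insert x T)) * card V"
    by (simp add: mult.commute)
  also have "\<dots> \<le> card (star ?G T)"
    using le by (simp add: card_cartesian_product)
  finally show ?thesis .
qed

section \<open>Covering a family by stars meeting one set\<close>

text \<open>A member \<open>A\<close> through \<open>T\<close> cannot have
  \<open>A \<inter> B \<subseteq> T\<close>, as this inclusion would be proper and leave fewer than
  \<open>t\<close> common elements. So \<open>A\<close> contains one of at most \<open>r\<close>
  elements of \<open>B - T\<close>. The multiplier \<open>c\<close> avoids division.\<close>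

lemma card_star_le_if_not_subset:
  assumes "finite \<G>" "\<A> \<subseteq> \<G>" and T: "t_set t T"
    and B: "finite B" "card B \<le> r" "\<not> T \<subseteq> B"
    and meet: "\<And>A. A \<in> \<A> \<Longrightarrow> t \<le> card (A \<inter> B)"
    and ext: "\<And>x. x \<notin> T \<Longrightarrow> c * card (star \<G> (insert x T)) \<le> L"
  shows "c * card (star \<A> T) \<le> r * L"
proof -
  have "star \<A> T \<subseteq> (\<Union>x\<in>B - T. star \<G> (insert x T))"
  proof
    fix A assume A: "A \<in> star \<A> T"
    have "\<not> A \<inter> B \<subseteq> T"
    proof
      assume "A \<inter> B \<subseteq> T"
      then have "A \<inter> B \<subset> T" using B by blast
      then have "card (A \<inter> B) < t" using T psubset_card_mono unfolding t_set_def by blast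
      then show False using meet[of A] A by (simp add: star_def)
    qed
    then show "A \<in> (\<Union>x\<in>B - T. star \<G> (insert x T))"
      using A assms(2) by (auto simp: star_def)
  qed
  then have "card (star \<A> T) \<le> card (\<Union>x\<in>B - T. star \<G> (insert x T))"
    using assms(1) B by (intro card_mono) (auto simp: finite_star)
  also have "\<dots> \<le> (\<Sum>x\<in>B - T. card (star \<G> (insert x T)))"
    using B by (intro card_UN_le) auto
  finally have "c * card (star \<A> T) \<le> (\<Sum>x\<in>B - T. c * card (star \<G> (insert x T)))"
    by (metis mult_le_mono2 sum_distrib_left)
  also have "\<dots> \<le> card (B - T) * L"
    using ext sum_bounded_above[of "B - T" "\<lambda>x. c * card (star \<G> (insert x T))" L] by simp
  also have "\<dots> \<le> r * L"
    using B card_mono[of B "B - T"] by (intro mult_le_mono1) auto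
  finally show ?thesis .
qed

text \<open>Every member contains a \<open>t\<close>-subset of the fixed set \<open>B\<close>, so at
  most \<open>r choose t\<close> stars cover the family.\<close>

lemma card_le_if_stars_le:
  assumes "finite \<A>" and B: "finite B" "card B \<le> r"
    and meet: "\<And>A. A \<in> \<A> \<Longrightarrow> t \<le> card (A \<inter> B)"
    and stars: "\<And>T. t_set t T \<Longrightarrow> c * card (star \<A> T) \<le> N"
  shows "c * card \<A> \<le> (r choose t) * N"
proof -
  let ?Ts = "{T. T \<subseteq> B \<and> card T = t}"
  have finTs: "finite ?Ts" using B by simp
  have "\<A> \<subseteq> (\<Union>T\<in>?Ts. star \<A> T)"
  proof
    fix A assume A: "A \<in> \<A>"
    then obtain T where "T \<subseteq> A \<inter> B" "card T = t"
      using obtain_subset_with_card_n[OF meet] by metis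
    then show "A \<in> (\<Union>T\<in>?Ts. star \<A> T)" using A by (auto simp: star_def)
  qed
  then have "card \<A> \<le> card (\<Union>T\<in>?Ts. star \<A> T)"
    using assms(1) finTs by (intro card_mono) (auto simp: finite_star)
  also have "\<dots> \<le> (\<Sum>T\<in>?Ts. card (star \<A> T))"
    using finTs by (rule card_UN_le)
  finally have "c * card \<A> \<le> (\<Sum>T\<in>?Ts. c * card (star \<A> T))"
    by (metis mult_le_mono2 sum_distrib_left)
  also have "\<dots> \<le> card ?Ts * N"
    using stars B sum_bounded_above[of ?Ts "\<lambda>T. c * card (star \<A> T)" N]
    by (metis (mono_tags, lifting) finite_subset mem_Collect_eq of_nat_id t_set_def)
  also have "\<dots> \<le> (r choose t) * N"
    using B by (intro mult_le_mono1) (simp add: n_subsets binomial_right_mono)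
  finally show ?thesis .
qed

section \<open>Cross-intersection in an abstract family satisfying the swap inequality\<close>

context
  fixes \<G> :: "'b set set" and r t L :: nat
  assumes fin: "finite \<G>" and small: "\<And>G. G \<in> \<G> \<Longrightarrow> finite G \<and> card G \<le> r"
    and pos: "0 < L"
    and star_le: "\<And>T. t_set t T \<Longrightarrow> card (star \<G> T) \<le> L"
    and ext: "\<And>T x. \<lbrakk>t_set t T; x \<notin> T\<rbrakk> \<Longrightarrow> c_rr r t * card (star \<G> (insert x T)) \<le> L"
begin

text \<open>Each \<open>T\<close> is missed by some member of \<open>\<B>\<close>, which makes every
  \<open>t\<close>-star of \<open>\<A>\<close> small; a single member of \<open>\<B>\<close> then
  covers \<open>\<A>\<close> by few such stars.\<close>

lemma card_lt_if_no_common_t_set: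
  assumes \<A>: "\<A> \<subseteq> \<G>" and \<B>: "\<B> \<subseteq> \<G>" "\<B> \<noteq> {}"
    and cross: "\<And>A B. \<lbrakk>A \<in> \<A>; B \<in> \<B>\<rbrakk> \<Longrightarrow> t \<le> card (A \<inter> B)"
    and none: "\<And>T. t_set t T \<Longrightarrow> \<exists>B\<in>\<B>. \<not> T \<subseteq> B"
  shows "card \<A> < L"
proof -
  have stars: "c_rr r t * card (star \<A> T) \<le> r * L" if T: "t_set t T" for T
  proof -
    obtain B where "B \<in> \<B>" "\<not> T \<subseteq> B" using none[OF T] by blast
    then show ?thesis
      using card_star_le_if_not_subset[OF fin \<A> T, of B r "c_rr r t" L] small \<B> cross ext[OF T]
      by blast
  qed
  obtain B where B: "B \<in> \<B>" using \<B> by blast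
  have "c_rr r t * card \<A> \<le> (r choose t) * (r * L)"
    using card_le_if_stars_le[of \<A> B r t "c_rr r t" "r * L"] stars B small \<B> cross fin \<A>
    by (meson finite_subset subsetD)
  \<comment> \<open>The \<open>+ 1\<close> in \<open>c_rr\<close> and \<open>0 < L\<close> give
    strictness.\<close>
  also have "\<dots> < c_rr r t * L"
    using pos by (simp add: c_rr_def algebra_simps)
  finally show ?thesis by simp
qed

text \<open>\<open>\<A>\<close> may exceed \<open>L\<close>, but by a factor of at most
  \<open>r choose t\<close>. The set \<open>A\<close> misses \<open>T\<close>, so
  \<open>\<B>\<close>, being its own star at \<open>T\<close>, is smaller than \<open>L\<close> by
  the factor \<open>r / c_rr r t\<close>, which outweighs this.\<close>

lemma card_mult_lt_if_common_t_set:
  assumes \<A>: "\<A> \<subseteq> \<G>" and \<B>: "\<B> \<subseteq> \<G>" "\<B> \<noteq> {}"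
    and cross: "\<And>A B. \<lbrakk>A \<in> \<A>; B \<in> \<B>\<rbrakk> \<Longrightarrow> t \<le> card (A \<inter> B)"
    and T: "t_set t T" "\<And>B. B \<in> \<B> \<Longrightarrow> T \<subseteq> B" and A: "A \<in> \<A>" "\<not> T \<subseteq> A"
  shows "card \<A> * card \<B> < L * L"
proof -
  have "star \<B> T = \<B>" using T by (auto simp: star_def)
  then have b: "c_rr r t * card \<B> \<le> r * L"
    using card_star_le_if_not_subset[OF fin \<B>(1) T(1), of A r "c_rr r t" L]
      small \<A> A cross ext[OF T(1)] by (metis inf_commute subsetD)
  have "card (star \<A> T') \<le> L" if "t_set t T'" for T'
    using star_le[OF that] card_mono[OF finite_star[OF fin] star_mono[OF \<A>]] le_trans by blast
  moreover obtain B where B: "B \<in> \<B>" using \<B> by blast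
  ultimately have a: "card \<A> \<le> (r choose t) * L"
    using card_le_if_stars_le[of \<A> B r t 1 L] small \<B> cross fin \<A>
    by (simp add: finite_subset subset_iff)
  have "c_rr r t * (card \<A> * card \<B>) \<le> (r choose t) * L * (r * L)"
    using mult_le_mono[OF a b] by (simp add: algebra_simps)
  also have "\<dots> < c_rr r t * (L * L)"
    using pos by (simp add: c_rr_def algebra_simps)
  finally show ?thesis by simp
qed

text \<open>The cases ask which of the two families have a common \<open>t\<close>-set. If both
  contain the same \<open>T\<close>, they lie in a star of size at most \<open>L\<close>, and only
  the full star attains equality.\<close>

lemma cross_pair:
  assumes \<A>: "\<A> \<subseteq> \<G>" and \<B>: "\<B> \<subseteq> \<G>"
    and cross: "\<And>A B. \<lbrakk>A \<in> \<A>; B \<in> \<B>\<rbrakk> \<Longrightarrow> t \<le> card (A \<inter> B)"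
  shows "card \<A> * card \<B> < L * L \<or>
    card \<A> = L \<and> card \<B> = L \<and> (\<exists>T. t_set t T \<and> \<A> = star \<G> T \<and> \<B> = star \<G> T)"
proof (cases "\<A> = {} \<or> \<B> = {}")
  case True
  then show ?thesis using pos by auto
next
  case False
  have cross': "t \<le> card (B \<inter> A)" if "A \<in> \<A>" "B \<in> \<B>" for A B
    using cross that by (simp add: inf_commute)
  consider (none) "\<And>T. t_set t T \<Longrightarrow> \<exists>B\<in>\<B>. \<not> T \<subseteq> B" "\<And>T. t_set t T \<Longrightarrow> \<exists>A\<in>\<A>. \<not> T \<subseteq> A"
    | (left) T A where "t_set t T" "\<And>B. B \<in> \<B> \<Longrightarrow> T \<subseteq> B" "A \<in> \<A>" "\<not> T \<subseteq> A"
    | (right) T B where "t_set t T" "\<And>A. A \<in> \<A> \<Longrightarrow> T \<subseteq> A" "B \<in> \<B>" "\<not> T \<subseteq> B"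
    | (both) T where "t_set t T" "\<And>A. A \<in> \<A> \<Longrightarrow> T \<subseteq> A" "\<And>B. B \<in> \<B> \<Longrightarrow> T \<subseteq> B"
    by metis
  then show ?thesis
  proof cases
    case none
    then have "card \<A> < L" "card \<B> < L"
      using card_lt_if_no_common_t_set[of \<A> \<B>] card_lt_if_no_common_t_set[of \<B> \<A>]
        \<A> \<B> False cross cross' by blast+
    then show ?thesis by (simp add: mult_strict_mono)
  next
    case left
    then show ?thesis
      using card_mult_lt_if_common_t_set[of \<A> \<B>] \<A> \<B> False cross by blast
  next
    case right
    then have "card \<B> * card \<A> < L * L"
      using card_mult_lt_if_common_t_set[of \<B> \<A>] \<A> \<B> False cross' by blast
    then show ?thesis by (simp add: mult.commute)
  next
    case both
    then have sub: "\<A> \<subseteq> star \<G> T" "\<B> \<subseteq> star \<G> T" using \<A> \<B> by (auto simp: star_def)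
    note fins = finite_star[OF fin, of T]
    have le: "card \<A> \<le> card (star \<G> T)" "card \<B> \<le> card (star \<G> T)" "card (star \<G> T) \<le> L"
      using sub fins star_le[OF both(1)] by (auto intro: card_mono)
    show ?thesis
    proof (cases "card \<A> = L \<and> card \<B> = L")
      case True
      then have "\<A> = star \<G> T" "\<B> = star \<G> T"
        using le sub fins by (simp_all add: card_subset_eq)
      then show ?thesis using True both by blast
    next
      case False
      then have "card \<A> < L \<and> card \<B> \<le> L \<or> card \<A> \<le> L \<and> card \<B> < L" using le by linarith
      then have "card \<A> * card \<B> < L * L"
      proof (elim disjE conjE)
        assume "card \<A> < L" "card \<B> \<le> L"
        then have "card \<A> * card \<B> \<le> card \<A> * L" "card \<A> * L < L * L"
          using pos by simp_all
        then show ?thesis by (rule le_less_trans)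
      next
        assume "card \<A> \<le> L" "card \<B> < L"
        then have "card \<A> * card \<B> \<le> L * card \<B>" "L * card \<B> < L * L"
          using pos by simp_all
        then show ?thesis by (rule le_less_trans)
      qed
      then show ?thesis ..
    qed
  qed
qed

lemma cross_family:
  assumes k: "2 \<le> k" and cross: "cross_t_intersecting t k \<A>" and below: "below k \<A> (\<lambda>_. \<G>)"
  shows "(\<Prod>i\<in>{1..k}. card (\<A> i)) < L ^ k \<or>
    (\<Prod>i\<in>{1..k}. card (\<A> i)) = L ^ k \<and> (\<exists>T. t_set t T \<and> (\<forall>i\<in>{1..k}. \<A> i = star \<G> T))"
proof -
  let ?I = "{1..k}"
  have pair: "card (\<A> i) * card (\<A> j) < L * L \<or>
      card (\<A> i) = L \<and> card (\<A> j) = L \<and> (\<exists>T. t_set t T \<and> \<A> i = star \<G> T \<and> \<A> j = star \<G> T)"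
    if "i \<in> ?I" "j \<in> ?I" "i \<noteq> j" for i j
    using cross_pair[of "\<A> i" "\<A> j"] that cross below
    unfolding cross_t_intersecting_def below_def by blast
  show ?thesis
  proof (cases "\<forall>i\<in>?I. card (\<A> i) = L")
    case True
    then have eq: "\<A> i = \<A> j \<and> (\<exists>T. t_set t T \<and> \<A> i = star \<G> T)" if "i \<in> ?I" "j \<in> ?I" "i \<noteq> j" for i j
      using pair[OF that] that by auto
    have "1 \<in> ?I" "2 \<in> ?I" using k by auto
    \<comment> \<open>The \<open>T\<close> from \<open>pair\<close> may vary with the pair, but all
      the families coincide, so one \<open>T\<close> serves them all.\<close>
    then obtain T where "t_set t T" "\<A> 1 = star \<G> T" using eq[of 1 2] by auto
    moreover have "\<A> i = \<A> 1" if "i \<in> ?I" for i using eq[of 1 i] that \<open>1 \<in> ?I\<close> by (cases "i = 1") auto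
    ultimately have "\<forall>i\<in>?I. \<A> i = star \<G> T" by blast
    moreover have "(\<Prod>i\<in>?I. card (\<A> i)) = L ^ k" using True by simp
    ultimately show ?thesis using \<open>t_set t T\<close> by blast
  next
    case False
    then obtain i0 where i0: "i0 \<in> ?I" "card (\<A> i0) \<noteq> L" by blast
    \<comment> \<open>Choose \<open>i\<close> with size above \<open>L\<close> if there is one. Two
      such indices would violate \<open>pair\<close>, so all other sizes are at most
      \<open>L\<close>.\<close>
    obtain i where i: "i \<in> ?I" "card (\<A> i) \<noteq> L"
      and big: "\<exists>j\<in>?I. L < card (\<A> j) \<Longrightarrow> L < card (\<A> i)"
      using i0 by (metis less_irrefl)
    have others: "card (\<A> j) \<le> L" if "j \<in> ?I" "j \<noteq> i" for j
    proof (rule ccontr)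
      assume j: "\<not> card (\<A> j) \<le> L"
      then have "L < card (\<A> i)" using big that by force
      then have "L * L < card (\<A> i) * card (\<A> j)" using j by (intro mult_strict_mono) auto
      then show False using pair[OF i(1) that(1)] that j by auto
    qed
    obtain j where j: "j \<in> ?I" "j \<noteq> i"
    proof (cases "i = 1")
      case True
      then show ?thesis using that[of 2] k by auto
    next
      case False
      then show ?thesis using that[of 1] k by auto
    qed
    \<comment> \<open>Since the size at \<open>i\<close> differs from \<open>L\<close>, the pair
      \<open>i\<close>, \<open>j\<close> contributes less than \<open>L * L\<close>; the other
      \<open>k - 2\<close> factors are at most \<open>L\<close>.\<close>
    have "(\<Prod>l\<in>?I. card (\<A> l)) = card (\<A> i) * card (\<A> j) * (\<Prod>l\<in>?I - {i} - {j}. card (\<A> l))"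
      using i j prod.remove[of ?I i "\<lambda>l. card (\<A> l)"] prod.remove[of "?I - {i}" j "\<lambda>l. card (\<A> l)"]
      by (simp add: mult.assoc)
    also have "\<dots> \<le> card (\<A> i) * card (\<A> j) * (\<Prod>l\<in>?I - {i} - {j}. L)"
      using others by (intro mult_le_mono2 prod_mono) auto
    also have "\<dots> < L * L * (\<Prod>l\<in>?I - {i} - {j}. L)"
      using pair[OF i(1) j(1)] i j pos by (intro mult_strict_right_mono) auto
    also have "\<dots> = L ^ k"
    proof -
      have "card (?I - {i} - {j}) = k - 2" using i j by (simp add: card_Diff_singleton)
      moreover have "L ^ k = L ^ 2 * L ^ (k - 2)" using k by (metis le_add_diff_inverse power_add)
      ultimately show ?thesis by (simp add: power2_eq_square)
    qed
    finally show ?thesis ..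
  qed
qed

lemma extrastrong_if_max:
  assumes k: "2 \<le> k" and T: "t_set t T" "card (star \<G> T) = L"
    and Fs: "\<And>i. i \<in> {1..k} \<Longrightarrow> Fs i = \<G>"
  shows "extrastrong_cross_t_star t k Fs"
proof -
  have "(\<Prod>i\<in>{1..k}. card (\<A> i)) \<le> (\<Prod>i\<in>{1..k}. card (star (Fs i) T)) \<and>
      ((\<Prod>i\<in>{1..k}. card (\<A> i)) = (\<Prod>i\<in>{1..k}. card (star (Fs i) T)) \<longrightarrow>
         (\<exists>T'. t_set t T' \<and> (\<forall>i\<in>{1..k}. \<A> i = star (Fs i) T')))"
    if "cross_t_intersecting t k \<A>" "below k \<A> Fs" for \<A>
  proof -
    have "below k \<A> (\<lambda>_. \<G>)" using that(2) Fs by (simp add: below_def)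
    moreover have "(\<Prod>i\<in>{1..k}. card (star (Fs i) T)) = L ^ k" using Fs T by simp
    ultimately show ?thesis using cross_family[OF k that(1)] Fs by auto
  qed
  then show ?thesis unfolding extrastrong_cross_t_star_def using T by blast
qed

end

section \<open>Application to graphs of injections\<close>

text \<open>Makes the largest star nonempty, hence \<open>0 < L\<close>. Here
  \<open>1 \<le> t\<close> ensures \<open>X \<noteq> {}\<close>, since the empty set contributes no
  graph.\<close>

lemma star_Sstar_family_nonempty:
  assumes X: "X \<in> \<F>" "finite X" "card X \<le> m" "t \<le> card X" "1 \<le> t"
  shows "\<exists>T. t_set t T \<and> star (Sstar_family \<F> m) T \<noteq> {}"
proof -
  obtain y where "inj_on y X" "y ` X \<subseteq> {1..m}"
    using card_le_inj[of X "{1..m}"] X by auto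
  moreover have "X \<noteq> {}" using X by auto
  ultimately have F: "(\<lambda>x. (x, y x)) ` X \<in> Sstar_family \<F> m"
    using X unfolding Sstar_family_def Sstar_def by auto
  have "card ((\<lambda>x. (x, y x)) ` X) = card X" by (intro card_image) (auto simp: inj_on_def)
  then obtain T where "T \<subseteq> (\<lambda>x. (x, y x)) ` X" "card T = t" "finite T"
    using obtain_subset_with_card_n X by metis
  then show ?thesis using F unfolding t_set_def star_def by blast
qed

theorem theorem4p7:
  fixes t r m k :: nat
    and \<F> :: "'a set set"
    and Fs :: "nat \<Rightarrow> ('a \<times> nat) set set"
  assumes "1 \<le> t" and "t \<le> r"
    and "le_family r \<F>"
    and "\<F> \<subseteq> {{}} \<or> (\<exists>X\<in>\<F>. t \<le> card X)"
    and "m \<ge> c_rr r t + t"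
    and "k \<ge> 2"
    and "\<And>i. i \<in> {1..k} \<Longrightarrow> Fs i = Sstar_family \<F> m"
  shows "extrastrong_cross_t_star t k Fs"
proof -
  let ?G = "Sstar_family \<F> m"
  note fin = finite_Sstar_family[OF assms(3), of m]
  \<comment> \<open>\<open>t_set\<close> ranges over all sets of pairs, so a \<open>t\<close>-set
    exists whatever \<open>\<F>\<close> is; \<open>T\<close> below is one with a largest
    star.\<close>
  have "infinite (UNIV :: ('a \<times> nat) set)" by (simp add: finite_prod)
  then obtain T0 :: "('a \<times> nat) set" where T0: "t_set t T0"
    using infinite_arbitrarily_large unfolding t_set_def by blast
  have "\<forall>T. t_set t T \<longrightarrow> card (star ?G T) < Suc (card ?G)"
    using fin by (auto simp: star_def less_Suc_eq_le intro: card_mono)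
  then obtain T where T: "t_set t T" "\<And>T'. t_set t T' \<Longrightarrow> card (star ?G T') \<le> card (star ?G T)"
    using ex_has_greatest_nat[of "t_set t" T0 "\<lambda>T. card (star ?G T)"] T0 by blast
  show ?thesis
  proof (cases "\<F> \<subseteq> {{}}")
    case True
    \<comment> \<open>The only tuple below is empty on \<open>{1..k}\<close> and equals the tuple of
      stars, which are empty too.\<close>
    then have "?G = {}" by (auto simp: Sstar_family_iff)
    then have eq: "\<forall>i\<in>{1..k}. \<A> i = star (Fs i) T" if "below k \<A> Fs" for \<A>
      using that assms(7) by (auto simp: below_def star_def)
    then have "(\<Prod>i\<in>{1..k}. card (\<A> i)) = (\<Prod>i\<in>{1..k}. card (star (Fs i) T))"
      if "below k \<A> Fs" for \<A>
      using that by (intro prod.cong) auto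
    then show ?thesis
      unfolding extrastrong_cross_t_star_def using T(1) eq by (intro exI[of _ T]) force
  next
    case False
    then obtain X where X: "X \<in> \<F>" "t \<le> card X" using assms(4) by blast
    \<comment> \<open>From \<open>t \<le> r\<close> the binomial coefficient is positive, so
      \<open>m\<close> is large enough for injections from \<open>X\<close>.\<close>
    have "r * 1 \<le> r * (r choose t)"
      using assms(2) by (intro mult_le_mono2) (simp add: Suc_leI)
    then have "r \<le> m" using assms(5) unfolding c_rr_def by linarith
    then obtain T' where T': "t_set t T'" "star ?G T' \<noteq> {}"
      using star_Sstar_family_nonempty[of X \<F> m t] X assms(1,3) unfolding le_family_def by force
    then have pos: "0 < card (star ?G T)"
      using T(2)[OF T'(1)] finite_star[OF fin] by (metis card_gt_0_iff gr0I le_zero_eq)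
    have "c_rr r t * card (star ?G (insert x S)) \<le> card (star ?G T)" if S: "t_set t S" "x \<notin> S" for S x
    proof -
      \<comment> \<open>The bound on \<open>m\<close> says exactly that the swap factor
        \<open>m - t\<close> is at least \<open>c_rr r t\<close>.\<close>
      have "c_rr r t * card (star ?G (insert x S)) \<le> (m - t) * card (star ?G (insert x S))"
        using assms(5) by (intro mult_le_mono1) simp
      also have "\<dots> \<le> card (star ?G T)"
        using card_star_insert_le[OF assms(3) S, of m] T(2)[OF S(1)] by linarith
      finally show ?thesis .
    qed
    then show ?thesis
      using fin Sstar_family_finite_card[OF assms(3)] pos T assms(6,7)
      by (intro extrastrong_if_max[where \<G> = ?G and r = r and T = T]) auto
  qed
qed

end
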